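(* Let $G$ be a labeled graph rooted at a vertex $v_i$ labeled $i$, let $G^*$ be the graph obtained from $G$ by adding one new isolated vertex labeled $j$ (rooted at the root of $G$), and let $X$ be the label set of $G^*$. Then the following are equivalent: (a) $G^*$ is stem-symmetric at $v_i$; (b) $\operatorname{Fer}^i(G^* )$ acts transitively on $X\setminus\{i\}$; (c) every orbit of $\operatorname{Fer}^i(G)$ acting on $X\setminus\{i,j\}$ contains (the label of) a leaf of $G$.
   Context: All graphs are finite and simple; a leaf is a vertex of degree $1$. A labeled graph $G$ comes with a bijection $\lambda:V(G)\to X$ onto a label set $X$; write $v_x=\lambda^{-1}(x)$ and $L_G=\{ij: v_iv_j\in E(G)\}$ (unordered pairs). For $\sigma\in\operatorname{Sym}(X)$, $G_\sigma$ is the graph on $V(G)$ with edge set $\{v_iv_j:\sigma(i)\sigma(j)\in L_G\}$. $\operatorname{Aut}(G)$ is identified with $\{\sigma\in\operatorname{Sym}(X): G_\sigma=G\}$. An edge-replacement $rs\to kl$ removes an edge $v_rv_s\in E(G)$ and adds $v_kv_l\in E(\overline G)\cup\{v_rv_s\}$; it is feasible if $G-v_rv_s+v_kv_l\cong G$. $R_G$ is the set of feasible edge-replacements $rs\to kl$ with $rs\ne kl$ together with the neutral replacement $\emptyset\to\emptyset$ (nothing changes). $\operatorname{Fer}_G(rs\to kl)=\{\sigma\in\operatorname{Sym}(X): G_\sigma=G-v_rv_s+v_kv_l\}$ and $\operatorname{Fer}_G(\emptyset\to\emptyset)=\operatorname{Aut}(G)$. $\mathcal{E}_G$ is the union of the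 sets $\operatorname{Fer}_G(e\to e')$ over all $e\to e'\in R_G$. For $i\in X$, $\mathcal{E}_G^i=\{\sigma\in\mathcal{E}_G:\sigma(i)=i\}$ and $\operatorname{Fer}^i(G)=\langle\mathcal{E}_G^i\rangle\le\operatorname{Sym}(X)$. $G$ is stem-symmetric at the vertex $v_i$ (or at the label $i$) if $\operatorname{Fer}^i(G)\cong S_{|V(G)|-1}$.
   Formalization: G is additionally assumed to have an edge or to consist of one vertex: for edgeless G with at least two vertices (a) and (b) hold, but (c) fails since G has no leaf. *)

theory Defs
  imports "HOL-Algebra.Group_Action" "HOL-Algebra.Generated_Groups" "HOL-Algebra.Sym_Groups"
begin

record ('v, 'x) lgraph =
  verts :: "'v set"
  edges :: "'v set set"
  lab :: "'v \<Rightarrow> 'x"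

text \<open>The label set is the image of the vertex set, so the labelling is a bijection onto it as
  soon as it is injective on the vertices.\<close>

definition labels :: "('v, 'x) lgraph \<Rightarrow> 'x set" where
  "labels G = lab G ` verts G"

definition labeled_graph :: "('v, 'x) lgraph \<Rightarrow> bool" where
  "labeled_graph G \<longleftrightarrow>
     finite (verts G) \<and>
     edges G \<subseteq> {{u, v} | u v. u \<in> verts G \<and> v \<in> verts G \<and> u \<noteq> v} \<and>
     inj_on (lab G) (verts G)"

definition vert :: "('v, 'x) lgraph \<Rightarrow> 'x \<Rightarrow> 'v" where
  "vert G = inv_into (verts G) (lab G)"

definition edge_labels :: "('v, 'x) lgraph \<Rightarrow> 'x set set" where
  "edge_labels G =
     {{i, j} | i j. i \<in> labels G \<and> j \<in> labels G \<and> {vert G i, vert G j} \<in> edges G}"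

definition degree :: "('v, 'x) lgraph \<Rightarrow> 'v \<Rightarrow> nat" where
  "degree G v = card {e \<in> edges G. v \<in> e}"

definition leaf :: "('v, 'x) lgraph \<Rightarrow> 'v \<Rightarrow> bool" where
  "leaf G v \<longleftrightarrow> v \<in> verts G \<and> degree G v = 1"

definition complement :: "('v, 'x) lgraph \<Rightarrow> ('v, 'x) lgraph" where
  "complement G =
     G\<lparr>edges := {{u, v} | u v. u \<in> verts G \<and> v \<in> verts G \<and> u \<noteq> v} - edges G\<rparr>"

text \<open>Isomorphism is that of the underlying unlabeled graphs.\<close>

definition graph_isomorphic :: "('v, 'x) lgraph \<Rightarrow> ('w, 'y) lgraph \<Rightarrow> bool" where
  "graph_isomorphic G H \<longleftrightarrow>
     (\<exists>f. bij_betw f (verts G) (verts H) \<and>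
          (\<forall>u\<in>verts G. \<forall>v\<in>verts G. {u, v} \<in> edges G \<longleftrightarrow> {f u, f v} \<in> edges H))"

text \<open>The group \<open>Sym(X)\<close> is \<^const>\<open>BijGroup\<close>: its elements are extensional, i.e. they are
  \<^const>\<open>undefined\<close> outside of \<open>X\<close>.\<close>

definition relabel :: "('v, 'x) lgraph \<Rightarrow> ('x \<Rightarrow> 'x) \<Rightarrow> ('v, 'x) lgraph" where
  "relabel G \<sigma> =
     G\<lparr>edges := {{vert G i, vert G j} | i j.
                   i \<in> labels G \<and> j \<in> labels G \<and> {\<sigma> i, \<sigma> j} \<in> edge_labels G}\<rparr>"

definition Aut :: "('v, 'x) lgraph \<Rightarrow> ('x \<Rightarrow> 'x) set" where
  "Aut G = {\<sigma> \<in> carrier (BijGroup (labels G)). relabel G \<sigma> = G}"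

text \<open>\<open>Neutral\<close> is the replacement written \<open>\<emptyset> \<rightarrow> \<emptyset>\<close>; \<open>Replace e e'\<close> is \<open>e \<rightarrow> e'\<close>, where \<open>e\<close> and \<open>e'\<close>
  are unordered pairs of labels.\<close>

datatype 'x replacement = Neutral | Replace "'x set" "'x set"

definition replace_edge ::
    "('v, 'x) lgraph \<Rightarrow> 'x set \<Rightarrow> 'x set \<Rightarrow> ('v, 'x) lgraph" where
  "replace_edge G e e' = G\<lparr>edges := (edges G - {vert G ` e}) \<union> {vert G ` e'}\<rparr>"

definition edge_replacement :: "('v, 'x) lgraph \<Rightarrow> 'x set \<Rightarrow> 'x set \<Rightarrow> bool" where
  "edge_replacement G e e' \<longleftrightarrow>
     e \<in> edge_labels G \<and> e' \<in> edge_labels (complement G) \<union> {e}"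

definition feasible :: "('v, 'x) lgraph \<Rightarrow> 'x set \<Rightarrow> 'x set \<Rightarrow> bool" where
  "feasible G e e' \<longleftrightarrow>
     edge_replacement G e e' \<and> graph_isomorphic (replace_edge G e e') G"

definition feasible_replacements :: "('v, 'x) lgraph \<Rightarrow> 'x replacement set" where
  "feasible_replacements G =
     {Replace e e' | e e'. feasible G e e' \<and> e \<noteq> e'} \<union> {Neutral}"

fun Fer :: "('v, 'x) lgraph \<Rightarrow> 'x replacement \<Rightarrow> ('x \<Rightarrow> 'x) set" where
  "Fer G Neutral = Aut G"
| "Fer G (Replace e e') =
     {\<sigma> \<in> carrier (BijGroup (labels G)). relabel G \<sigma> = replace_edge G e e'}"

definition Fer_union :: "('v, 'x) lgraph \<Rightarrow> ('x \<Rightarrow> 'x) set" where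
  "Fer_union G = (\<Union>r\<in>feasible_replacements G. Fer G r)"

definition Fer_union_fixing :: "('v, 'x) lgraph \<Rightarrow> 'x \<Rightarrow> ('x \<Rightarrow> 'x) set" where
  "Fer_union_fixing G i = {\<sigma> \<in> Fer_union G. \<sigma> i = i}"

definition Fer_group :: "('v, 'x) lgraph \<Rightarrow> 'x \<Rightarrow> ('x \<Rightarrow> 'x) monoid" where
  "Fer_group G i =
     (BijGroup (labels G))
       \<lparr>carrier := generate (BijGroup (labels G)) (Fer_union_fixing G i)\<rparr>"

definition stem_symmetric :: "('v, 'x) lgraph \<Rightarrow> 'x \<Rightarrow> bool" where
  "stem_symmetric G i \<longleftrightarrow> Fer_group G i \<cong> sym_group (card (verts G) - 1)"

text \<open>Permutations act on an invariant subset \<open>A\<close> of their domain by restriction; \<open>natural_action A\<close>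
  is the action map into \<^term>\<open>BijGroup A\<close>.\<close>

definition natural_action :: "'x set \<Rightarrow> ('x \<Rightarrow> 'x) \<Rightarrow> 'x \<Rightarrow> 'x" where
  "natural_action A = (\<lambda>\<sigma>. restrict \<sigma> A)"

definition add_isolated :: "('v, 'x) lgraph \<Rightarrow> 'v \<Rightarrow> 'x \<Rightarrow> ('v, 'x) lgraph" where
  "add_isolated G w j = G\<lparr>verts := insert w (verts G), lab := (lab G)(w := j)\<rparr>"

end

theory Submission
  imports Defs
begin

text \<open>
  A permutation \<open>\<sigma>\<close> belongs to \<open>\<E>\<^sub>G\<close> iff \<open>\<sigma>(L\<^sub>G)\<close> contains at most one pair outside \<open>L\<^sub>G\<close>: a
  set of the same size differing in one pair is an edge-replacement, feasible because \<open>\<sigma>\<close> itself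
  is an isomorphism. If such a \<open>\<sigma>\<close> sends the isolated label \<open>j\<close> to \<open>k\<close>, then \<open>k\<close> has degree at
  most 1 in \<open>G\<close>, so that \<open>(j k)\<close> moves at most one pair as well, and \<open>(j k)\<sigma>\<close> is an element of
  \<open>\<E>\<^sub>G\<close> fixing \<open>j\<close>. Hence \<open>Fer\<^sup>i(G\<^sup>*)\<close> is generated by \<open>\<E>\<^sub>G\<^sup>i\<close> and the transpositions \<open>(j k)\<close>
  with \<open>k\<close> of degree at most 1. The orbit of \<open>j\<close> therefore collects the orbits of \<open>Fer\<^sup>i(G)\<close>
  meeting such vertices, and if it is everything, then conjugation yields all transpositions
  \<open>(j x)\<close>, which generate the stabilizer of \<open>i\<close>. Isolated vertices can replace leaves in
  (c) only if there is no leaf besides the root; but then isolated vertices are never exchanged with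
  others, so that transitivity fails as soon as there is an edge.
\<close>

section \<open>Permutation groups on a finite set\<close>

lemma BijGroup_carrier [simp]: "carrier (BijGroup X) = Bij X"
  by (simp add: BijGroup_def)

lemma BijGroup_mult:
  "\<lbrakk>g \<in> Bij X; f \<in> Bij X\<rbrakk> \<Longrightarrow> g \<otimes>\<^bsub>BijGroup X\<^esub> f = compose X g f"
  by (simp add: BijGroup_def)

lemma finite_Bij: "finite X \<Longrightarrow> finite (Bij X)"
  by (rule finite_subset[OF _ finite_PiE[of X "\<lambda>_. X"]])
     (auto simp: Bij_def PiE_def dest: bij_betwE)

text \<open>Elements of \<open>BijGroup X\<close> are \<open>undefined\<close> outside
  \<open>X\<close>, hence the restriction.\<close>

definition swap_on :: "'x set \<Rightarrow> 'x \<Rightarrow> 'x \<Rightarrow> 'x \<Rightarrow> 'x" where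
  "swap_on X a b = restrict (Transposition.transpose a b) X"

lemma restrict_permutes_Bij:
  assumes "p permutes A" "A \<subseteq> X"
  shows "restrict p X \<in> Bij X"
  using permutes_imp_bij[OF permutes_subset[OF assms]]
  by (simp add: Bij_def)

lemma swap_on_Bij: "\<lbrakk>a \<in> X; b \<in> X\<rbrakk> \<Longrightarrow> swap_on X a b \<in> Bij X"
  unfolding swap_on_def
  by (rule restrict_permutes_Bij[OF permutes_swap_id]) auto

text \<open>An injective map of the finite set \<open>S\<close> into itself is onto. Equality passes
  directly to inverses, so it is what the induction over generated elements carries.\<close>

lemma generate_image_eq:
  assumes "finite X" "E \<subseteq> Bij X" "S \<subseteq> X"
    and inv: "\<And>\<sigma>. \<sigma> \<in> E \<Longrightarrow> \<sigma> ` S \<subseteq> S"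
    and g: "g \<in> generate (BijGroup X) E"
  shows "g ` S = S"
proof -
  have fS: "finite S" using assms(1,3) finite_subset by blast
  have incl: "\<sigma> ` S = S" if "\<sigma> \<in> E" for \<sigma>
  proof -
    have "inj_on \<sigma> S"
      using that assms(2,3) by (auto simp: Bij_def bij_betw_def intro: inj_on_subset)
    then show ?thesis using endo_inj_surj[OF fS inv[OF that]] by blast
  qed
  interpret group "BijGroup X" by (rule group_BijGroup)
  show ?thesis using g
  proof (induction rule: generate.induct)
    case one
    show ?case using assms(3) by (auto simp: BijGroup_def)
  next
    case (incl h)
    then show ?case using \<open>\<And>\<sigma>. \<sigma> \<in> E \<Longrightarrow> \<sigma> ` S = S\<close> by blast
  next
    case (inv h)
    then have h: "h \<in> Bij X" "h ` S = S" using assms(2) incl by auto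
    then have "inj_on h X" by (auto simp: Bij_def bij_betw_def)
    then have "inv_into X h ` (h ` S) = S"
      using assms(3) by (simp add: inv_into_image_cancel)
    moreover have "(inv\<^bsub>BijGroup X\<^esub> h) ` S = inv_into X h ` S"
      using h assms(3) by (auto simp: inv_BijGroup image_def)
    ultimately show ?case using h by simp
  next
    case (eng g h)
    have "g \<in> Bij X" "h \<in> Bij X"
      using eng(1,2) generate_in_carrier assms(2) by auto
    then have "(g \<otimes>\<^bsub>BijGroup X\<^esub> h) ` S = g ` (h ` S)"
      using assms(3) by (force simp: BijGroup_mult compose_def image_def)
    then show ?case using eng by simp
  qed
qed

section \<open>The stabilizer of a point as a symmetric group\<close>

text \<open>Extending by the identity instead of \<open>undefined\<close> makes the theory of
  \<open>permutes\<close>, with its induction over transpositions, applicable to extensional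
  permutations.\<close>

lemma Bij_fixing_extend_permutes:
  assumes "\<sigma> \<in> Bij X" "\<sigma> i = i" "i \<in> X"
  obtains p where "p permutes (X - {i})" "\<sigma> = restrict p X"
proof
  let ?p = "\<lambda>x. if x \<in> X then \<sigma> x else x"
  have b: "bij_betw \<sigma> X X" using assms by (simp add: Bij_def)
  then have "bij_betw ?p X X" by (simp cong: bij_betw_cong)
  then have "?p permutes X" by (rule bij_imp_permutes) simp
  then show "?p permutes (X - {i})"
    by (rule permutes_superset) (use assms in auto)
  show "\<sigma> = restrict ?p X"
    using assms by (auto simp: Bij_def extensional_def restrict_def)
qed

lemma stabilizer_iso_sym_group:
  assumes "finite X" "i \<in> X"
  shows "(BijGroup X)\<lparr>carrier := {\<sigma> \<in> Bij X. \<sigma> i = i}\<rparr> \<cong> sym_group (card X - 1)"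
proof -
  let ?n = "card X - 1" and ?A = "X - {i}"
  let ?S = "{\<sigma> \<in> Bij X. \<sigma> i = i}"
  define N where "N = {1..?n}"
  have "card ?A = card N" using assms by (simp add: N_def)
  then obtain b where b: "bij_betw b ?A N"
    using finite_same_card_bij[of ?A N] assms by (auto simp: N_def)
  define c where "c = inv_into ?A b"
  have c: "bij_betw c N ?A" unfolding c_def by (rule bij_betw_inv_into[OF b])
  have bc: "b (c k) = k" if "k \<in> N" for k
    using that b unfolding c_def by (simp add: bij_betw_inv_into_right)
  have cb: "c (b x) = x" if "x \<in> ?A" for x
    using that b unfolding c_def by (simp add: bij_betw_inv_into_left)
  have cA: "c k \<in> ?A" if "k \<in> N" for k using that c bij_betwE by blast
  have bA: "b x \<in> N" if "x \<in> ?A" for x using that b bij_betwE by blast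
  \<comment> \<open>Conjugation by \<open>b\<close>, completed by the identity because
    \<open>sym_group\<close> consists of total functions that move only elements of
    \<open>N\<close>.\<close>
  define f where "f \<sigma> = (\<lambda>k. if k \<in> N then b (\<sigma> (c k)) else k)" for \<sigma> :: "'a \<Rightarrow> 'a"
  have sA: "bij_betw \<sigma> ?A ?A" if s: "\<sigma> \<in> ?S" for \<sigma>
  proof -
    obtain p where "p permutes ?A" "\<sigma> = restrict p X"
      using Bij_fixing_extend_permutes[of \<sigma> X i] s assms(2) by blast
    then show ?thesis
      using permutes_imp_bij[of p ?A] bij_betw_cong[of ?A \<sigma> p ?A] by simp
  qed
  have fp: "f \<sigma> permutes N" if "\<sigma> \<in> ?S" for \<sigma>
  proof (rule bij_imp_permutes)
    have "bij_betw (b \<circ> (\<sigma> \<circ> c)) N N"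
      by (rule bij_betw_trans[OF bij_betw_trans[OF c sA[OF that]] b])
    then show "bij_betw (f \<sigma>) N N"
      by (rule iffD2[OF bij_betw_cong, rotated]) (simp add: f_def)
  qed (simp add: f_def)
  \<comment> \<open>The inverse conjugation; the default values make it fix \<open>i\<close> and be
    extensional on \<open>X\<close>.\<close>
  define g where "g p = (\<lambda>x. if x \<in> ?A then c (p (b x)) else if x = i then i else undefined)"
    for p :: "nat \<Rightarrow> nat"
  have gS: "g p \<in> ?S" if "p permutes N" for p
  proof -
    have "bij_betw (c \<circ> (p \<circ> b)) ?A ?A"
      by (rule bij_betw_trans[OF bij_betw_trans[OF b permutes_imp_bij[OF that]] c])
    then have "bij_betw (g p) ?A ?A"
      by (rule iffD2[OF bij_betw_cong, rotated]) (simp add: g_def)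
    then have "bij_betw (g p) (insert i ?A) (insert i ?A)"
      using notIn_Un_bij_betw[of i ?A "g p" ?A] by (simp add: g_def)
    then have "bij_betw (g p) X X" using assms by (simp add: insert_absorb)
    then show ?thesis using assms by (auto simp: Bij_def extensional_def g_def)
  qed
  have gf: "g (f \<sigma>) = \<sigma>" if "\<sigma> \<in> ?S" for \<sigma>
  proof
    fix x
    show "g (f \<sigma>) x = \<sigma> x"
    proof (cases "x \<in> ?A")
      case True
      then have "\<sigma> x \<in> ?A" using sA[OF that] bij_betwE by blast
      then show ?thesis using True bA[OF True] by (simp add: g_def f_def cb)
    next
      case False
      have "\<sigma> \<in> extensional X" using that by (simp add: Bij_imp_extensional)
      from extensional_arb[OF this, of x] False that show ?thesis
        by (cases "x = i") (simp_all add: g_def)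
    qed
  qed
  have fg: "f (g p) = p" if p: "p permutes N" for p
  proof
    fix k
    show "f (g p) k = p k"
    proof (cases "k \<in> N")
      case True
      then have "p k \<in> N" using permutes_in_image[OF p, of k] by simp
      then show ?thesis using True cA[OF True] by (simp add: g_def f_def bc)
    next
      case False
      then show ?thesis using permutes_not_in[OF p] by (simp add: f_def)
    qed
  qed
  have "bij_betw f ?S {p. p permutes N}"
    by (rule bij_betw_byWitness[where f' = g]) (use gf fg fp gS in auto)
  moreover have "f (compose X \<sigma> \<tau>) = f \<sigma> \<circ> f \<tau>" if "\<sigma> \<in> ?S" "\<tau> \<in> ?S" for \<sigma> \<tau>
  proof
    fix k
    show "f (compose X \<sigma> \<tau>) k = (f \<sigma> \<circ> f \<tau>) k"
    proof (cases "k \<in> N")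
      case True
      then have "c k \<in> ?A" by (rule cA)
      moreover have "\<tau> (c k) \<in> ?A" using sA[OF that(2)] calculation bij_betwE by blast
      ultimately show ?thesis using True bA[of "\<tau> (c k)"] by (simp add: f_def compose_def cb)
    next
      case False
      then show ?thesis by (simp add: f_def)
    qed
  qed
  ultimately have "f \<in> iso ((BijGroup X)\<lparr>carrier := ?S\<rparr>) (sym_group ?n)"
    using fp unfolding N_def
    by (auto simp: iso_def hom_def sym_group_def BijGroup_mult simp del: One_nat_def)
  then show ?thesis by (auto simp: is_iso_def)
qed

section \<open>Actions by restriction to an invariant subset\<close>

lemma group_action_restrict:
  assumes H: "subgroup H (BijGroup X)" and A: "A \<subseteq> X" and inv: "\<And>g. g \<in> H \<Longrightarrow> g ` A = A"
  shows "group_action ((BijGroup X)\<lparr>carrier := H\<rparr>) A (natural_action A)"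
proof -
  have HB: "H \<subseteq> Bij X" using subgroup.subset[OF H] by simp
  have B: "restrict g A \<in> Bij A" if "g \<in> H" for g
    using inv[OF that] HB that A by (auto simp: Bij_def bij_betw_def intro: inj_on_subset)
  have "natural_action A \<in> hom ((BijGroup X)\<lparr>carrier := H\<rparr>) (BijGroup A)"
  proof (rule homI)
    fix g h assume gh: "g \<in> carrier ((BijGroup X)\<lparr>carrier := H\<rparr>)"
      "h \<in> carrier ((BijGroup X)\<lparr>carrier := H\<rparr>)"
    then have "h x \<in> A" if "x \<in> A" for x using inv[of h] that by auto
    then show "natural_action A (g \<otimes>\<^bsub>(BijGroup X)\<lparr>carrier := H\<rparr>\<^esub> h) =
      natural_action A g \<otimes>\<^bsub>BijGroup A\<^esub> natural_action A h"
      using gh HB A B by (auto simp: natural_action_def BijGroup_mult compose_def restrict_def subset_iff)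
  qed (use B in \<open>auto simp: natural_action_def\<close>)
  moreover have "group ((BijGroup X)\<lparr>carrier := H\<rparr>)"
    using subgroup.subgroup_is_group[OF H group_BijGroup] .
  ultimately show ?thesis
    by (simp add: group_action_def group_hom_def group_hom_axioms_def group_BijGroup)
qed

section \<open>Permutations moving at most one edge\<close>

text \<open>The label-side counterpart of \<open>Fer_union_fixing\<close>, free of vertices,
  replacements and isomorphisms. An added isolated vertex changes \<open>X\<close> but not
  \<open>L\<close>, so both graphs can be treated with the same \<open>L\<close>.\<close>

definition near :: "'x set \<Rightarrow> 'x set set \<Rightarrow> 'x \<Rightarrow> ('x \<Rightarrow> 'x) set" where
  "near X L i = {\<sigma> \<in> Bij X. \<sigma> i = i \<and> card ((`) \<sigma> ` L - L) \<le> 1}"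

definition deg :: "'x set set \<Rightarrow> 'x \<Rightarrow> nat" where
  "deg L x = card {e \<in> L. x \<in> e}"

locale edge_system =
  fixes X :: "'x set" and L :: "'x set set" and i :: 'x
  assumes finite_X: "finite X"
    and edge: "e \<in> L \<Longrightarrow> e \<subseteq> X \<and> card e = 2"
    and i_in: "i \<in> X"
begin

text \<open>For the labels and label pairs of a graph this is the carrier of its
  \<open>Fer_group\<close> at \<open>i\<close>.\<close>

definition H where "H = generate (BijGroup X) (near X L i)"

lemma finite_L: "finite L"
  by (rule finite_subset[of _ "Pow X"]) (use finite_X edge in auto)

lemma near_Bij: "near X L i \<subseteq> Bij X"
  by (auto simp: near_def)

lemma H_subgroup: "subgroup H (BijGroup X)"
  unfolding H_def using group.generate_is_subgroup[OF group_BijGroup] near_Bij by simp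

lemma H_Bij: "g \<in> H \<Longrightarrow> g \<in> Bij X"
  using subgroup.subset[OF H_subgroup] by auto

lemma H_compose: "\<lbrakk>g \<in> H; h \<in> H\<rbrakk> \<Longrightarrow> compose X g h \<in> H"
  using subgroup.m_closed[OF H_subgroup, of g h] H_Bij BijGroup_mult by metis

lemma near_H: "\<sigma> \<in> near X L i \<Longrightarrow> \<sigma> \<in> H"
  unfolding H_def by (rule generate.incl)

text \<open>Checking a set on generators controls the whole group. All orbit arguments below rest on
  this, without writing elements as words in the generators.\<close>

lemma H_image_eq:
  assumes "S \<subseteq> X" "\<And>\<sigma>. \<sigma> \<in> near X L i \<Longrightarrow> \<sigma> ` S \<subseteq> S" "g \<in> H"
  shows "g ` S = S"
  using generate_image_eq[OF finite_X near_Bij assms(1,2)] assms(3) unfolding H_def by blast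

lemma H_fixes_i: "g \<in> H \<Longrightarrow> g i = i"
  using H_image_eq[of "{i}" g] i_in by (auto simp: near_def)

lemma H_image_minus_i: "g \<in> H \<Longrightarrow> g ` (X - {i}) = X - {i}"
proof -
  assume g: "g \<in> H"
  have "inj_on g X" "g ` X = X" using H_Bij[OF g] by (auto simp: Bij_def bij_betw_def)
  then show ?thesis using H_fixes_i[OF g] i_in inj_on_image_set_diff[of g X X "{i}"] by simp
qed

lemma H_sym: "\<lbrakk>g \<in> H; x \<in> X\<rbrakk> \<Longrightarrow> \<exists>h\<in>H. h (g x) = x"
proof -
  assume g: "g \<in> H" and x: "x \<in> X"
  have "inv\<^bsub>BijGroup X\<^esub> g \<in> H" using subgroup.m_inv_closed[OF H_subgroup g] .
  moreover have "(inv\<^bsub>BijGroup X\<^esub> g) (g x) = x"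
    using H_Bij[OF g] x by (auto simp: inv_BijGroup Bij_def bij_betw_def)
  ultimately show ?thesis by blast
qed

section \<open>Counting the edges moved by a permutation\<close>

text \<open>A permutation acts injectively on subsets of \<open>X\<close>, so \<open>L\<close> and
  its image are equinumerous, and so are their two differences.\<close>

lemma card_image_diff:
  assumes "\<sigma> \<in> Bij X"
  shows "card ((`) \<sigma> ` L - L) = card (L - (`) \<sigma> ` L)"
proof (rule card_le_sym_Diff[THEN antisym])
  have "inj_on ((`) \<sigma>) (Pow X)"
    using assms by (auto simp: Bij_def bij_betw_def inj_on_image_Pow)
  then have "inj_on ((`) \<sigma>) L" by (rule inj_on_subset) (use edge in auto)
  then have "card ((`) \<sigma> ` L) = card L" by (rule card_image)
  then show "card ((`) \<sigma> ` L) \<le> card L" "card (L - (`) \<sigma> ` L) \<le> card ((`) \<sigma> ` L - L)"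
    using card_le_sym_Diff[of L "(`) \<sigma> ` L"] finite_L by auto
qed (use finite_L in auto)

text \<open>Relabelling takes preimages of edges, \<open>near\<close> takes images. Applying
  \<open>\<sigma>\<close> maps the new preimages bijectively onto the edges not hit by
  \<open>\<sigma>\<close>, and \<open>card_image_diff\<close> turns their number into that of the
  new images.\<close>

lemma near_preimage:
  assumes "\<sigma> \<in> Bij X"
  shows "card ({e. e \<subseteq> X \<and> \<sigma> ` e \<in> L} - L) = card ((`) \<sigma> ` L - L)"
proof -
  have inj: "inj_on ((`) \<sigma>) (Pow X)" and surj: "(`) \<sigma> ` Pow X = Pow X"
    using assms by (simp_all add: Bij_def bij_betw_def inj_on_image_Pow image_Pow_surj)
  have "(`) \<sigma> ` ({e. e \<subseteq> X \<and> \<sigma> ` e \<in> L} - L) = L - (`) \<sigma> ` L"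
  proof (intro equalityI subsetI)
    fix e assume "e \<in> (`) \<sigma> ` ({e. e \<subseteq> X \<and> \<sigma> ` e \<in> L} - L)"
    then obtain d where d: "d \<subseteq> X" "\<sigma> ` d \<in> L" "d \<notin> L" "e = \<sigma> ` d" by auto
    then show "e \<in> L - (`) \<sigma> ` L"
      using inj edge by (auto dest!: inj_onD[OF inj])
  next
    fix e assume e: "e \<in> L - (`) \<sigma> ` L"
    then have "e \<in> (`) \<sigma> ` Pow X" using edge surj by auto
    then obtain d where "d \<subseteq> X" "e = \<sigma> ` d" by blast
    then show "e \<in> (`) \<sigma> ` ({e. e \<subseteq> X \<and> \<sigma> ` e \<in> L} - L)" using e by auto
  qed
  moreover have "inj_on ((`) \<sigma>) ({e. e \<subseteq> X \<and> \<sigma> ` e \<in> L} - L)"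
    by (rule inj_on_subset[OF inj]) auto
  ultimately show ?thesis using card_image_diff[OF assms] by (metis card_image)
qed

text \<open>As \<open>x\<close> lies on no edge, \<open>\<sigma> x\<close> lies on no image of an
  edge. Every edge at \<open>\<sigma> x\<close> is therefore outside the image of \<open>L\<close>,
  and there is at most one such edge.\<close>

lemma deg_image_isolated:
  assumes "\<sigma> \<in> near X L i" "x \<in> X" "deg L x = 0"
  shows "deg L (\<sigma> x) \<le> 1"
proof -
  have e: "x \<notin> e" if "e \<in> L" for e
    using assms(3) finite_L that by (auto simp: deg_def)
  have B: "\<sigma> \<in> Bij X" using assms by (simp add: near_def)
  then have inj: "inj_on \<sigma> X" by (simp add: Bij_def bij_betw_def)
  have "{e \<in> L. \<sigma> x \<in> e} \<subseteq> L - (`) \<sigma> ` L"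
  proof
    fix d assume d: "d \<in> {e \<in> L. \<sigma> x \<in> e}"
    have "\<sigma> x \<notin> \<sigma> ` e" if "e \<in> L" for e
      using e[OF that] edge[OF that] inj_on_image_mem_iff[OF inj assms(2), of e] by simp
    then show "d \<in> L - (`) \<sigma> ` L" using d by blast
  qed
  then have "deg L (\<sigma> x) \<le> card (L - (`) \<sigma> ` L)"
    unfolding deg_def by (rule card_mono[rotated]) (use finite_L in auto)
  then show ?thesis using assms card_image_diff[OF B] by (simp add: near_def)
qed

end

lemma swap_on_image_id:
  assumes "e \<subseteq> X" "a \<notin> e" "b \<notin> e"
  shows "swap_on X a b ` e = e"
proof -
  have "swap_on X a b x = x" if "x \<in> e" for x
    using that assms by (auto simp: swap_on_def transpose_def)
  then show ?thesis by simp
qed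

section \<open>Adding an isolated vertex\<close>

locale isolated = edge_system +
  fixes j :: 'a
  assumes j_in: "j \<in> X" and ij: "i \<noteq> j" and j_isolated: "e \<in> L \<Longrightarrow> j \<notin> e"
begin

text \<open>Here \<open>X\<close> plays the labels of the extended graph and \<open>X - {j}\<close>
  those of the original one; thus \<open>base.H\<close> belongs to the original graph and
  \<open>H\<close> to the extended one.\<close>

sublocale base: edge_system "X - {j}" L i
  by unfold_locales (use finite_X edge i_in ij j_isolated in auto)

lemma deg_j: "deg L j = 0"
proof -
  have "{e \<in> L. j \<in> e} = {}" using j_isolated by auto
  then show ?thesis by (simp only: deg_def card.empty)
qed

section \<open>Comparing the generators with and without the isolated label\<close>

text \<open>No edge contains \<open>j\<close>, so only edges through \<open>k\<close> can move, and
  there is at most one of these.\<close>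

lemma near_swap_on:
  assumes "k \<in> X - {i}" "deg L k \<le> 1"
  shows "swap_on X j k \<in> near X L i"
proof -
  let ?t = "swap_on X j k"
  have "(`) ?t ` L - L \<subseteq> (`) ?t ` {e \<in> L. k \<in> e}"
  proof
    fix d assume "d \<in> (`) ?t ` L - L"
    then obtain e where e: "e \<in> L" "d = ?t ` e" "d \<notin> L" by auto
    then have "k \<in> e" using edge j_isolated swap_on_image_id[of e X j k] by metis
    then show "d \<in> (`) ?t ` {e \<in> L. k \<in> e}" using e by auto
  qed
  then have "card ((`) ?t ` L - L) \<le> card ((`) ?t ` {e \<in> L. k \<in> e})"
    by (rule card_mono[rotated]) (use finite_L in auto)
  also have "\<dots> \<le> card {e \<in> L. k \<in> e}" by (rule card_image_le) (use finite_L in auto)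
  also have "\<dots> \<le> 1" using assms(2) by (simp add: deg_def)
  finally show ?thesis
    using assms(1) j_in i_in ij swap_on_Bij[of j X k]
    by (auto simp: near_def swap_on_def transpose_def)
qed

text \<open>The value at \<open>j\<close> does not affect images of edges, since \<open>j\<close> is
  on none of them.\<close>

lemma near_extend:
  assumes "\<tau> \<in> near (X - {j}) L i"
  shows "\<tau>(j := j) \<in> near X L i"
proof -
  have im: "\<tau>(j := j) ` e = \<tau> ` e" if "e \<in> L" for e
    using j_isolated[OF that] by auto
  have t: "bij_betw \<tau> (X - {j}) (X - {j})" "\<tau> \<in> extensional (X - {j})"
    using assms by (auto simp: near_def Bij_def)
  then have "bij_betw (\<tau>(j := j)) (X - {j}) (X - {j})"
    using bij_betw_cong[of "X - {j}" "\<tau>(j := j)" \<tau> "X - {j}"] by simp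
  then have "bij_betw (\<tau>(j := j)) (insert j (X - {j})) (insert j (X - {j}))"
    using notIn_Un_bij_betw[of j "X - {j}" "\<tau>(j := j)" "X - {j}"] by simp
  then have "\<tau>(j := j) \<in> Bij X"
    using t j_in by (auto simp: Bij_def insert_absorb extensional_def)
  moreover have "(`) (\<tau>(j := j)) ` L = (`) \<tau> ` L" using im by (rule image_cong[OF refl])
  ultimately show ?thesis using assms ij by (simp add: near_def)
qed

text \<open>With \<open>k = \<sigma> j\<close>, undoing the swap of \<open>j\<close> and
  \<open>k\<close> after \<open>\<sigma>\<close> fixes \<open>j\<close> and creates no further new
  pair. For \<open>k = j\<close> the swap is the identity.\<close>

lemma near_decompose:
  assumes "\<sigma> \<in> near X L i"
  obtains \<tau> k where "\<tau> \<in> near (X - {j}) L i" "k \<in> X - {i}" "deg L k \<le> 1"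
    "\<And>x. x \<in> X \<Longrightarrow> \<sigma> x = swap_on X j k ((\<tau>(j := j)) x)"
proof -
  define k where "k = \<sigma> j"
  define \<tau> where "\<tau> = restrict (Transposition.transpose j k \<circ> \<sigma>) (X - {j})"
  have B: "bij_betw \<sigma> X X" and si: "\<sigma> i = i" using assms by (auto simp: near_def Bij_def)
  then have inj: "inj_on \<sigma> X" and im: "\<sigma> ` X = X" by (auto simp: bij_betw_def)
  have kX: "k \<in> X" using im j_in by (auto simp: k_def)
  have ki: "k \<noteq> i" using inj_onD[OF inj, of j i] si j_in i_in ij by (auto simp: k_def)
  have bt: "bij_betw (Transposition.transpose j k \<circ> \<sigma>) (X - {j}) (X - {j})"
  proof -
    have "bij_betw (Transposition.transpose j k) X X"
      by (rule permutes_imp_bij[OF permutes_swap_id]) (use kX j_in in auto)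
    with B have "bij_betw (Transposition.transpose j k \<circ> \<sigma>) X X"
      by (rule bij_betw_trans)
    then have "bij_betw (Transposition.transpose j k \<circ> \<sigma>) (X - {j}) (X - {(Transposition.transpose j k \<circ> \<sigma>) j})"
      using j_in by (intro bij_betw_DiffI) (auto simp: bij_betw_def)
    then show ?thesis by (simp add: k_def)
  qed
  then have tB: "\<tau> \<in> Bij (X - {j})" by (simp add: \<tau>_def Bij_def)
  have tim: "\<tau> ` e = Transposition.transpose j k ` \<sigma> ` e" if "e \<in> L" for e
    using edge[OF that] j_isolated[OF that] by (auto simp: \<tau>_def subset_iff image_comp)
  have "(`) \<tau> ` L - L \<subseteq> (`) (Transposition.transpose j k) ` ((`) \<sigma> ` L - L)"
  proof
    fix d assume "d \<in> (`) \<tau> ` L - L"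
    then obtain e where e: "e \<in> L" "d = Transposition.transpose j k ` \<sigma> ` e" "d \<notin> L"
      using tim by auto
    \<comment> \<open>An image that is an edge contains neither the isolated \<open>j\<close> nor
      \<open>k\<close>, which is the image of \<open>j\<close> only. The transposition leaves it
      alone, so it cannot become a new pair.\<close>
    have "\<sigma> ` e \<notin> L"
    proof
      assume a: "\<sigma> ` e \<in> L"
      have "k \<notin> \<sigma> ` e"
        using inj_on_image_mem_iff[OF inj j_in, of e] edge[OF e(1)] j_isolated[OF e(1)] by (simp add: k_def)
      then have "d = \<sigma> ` e" using j_isolated[OF a] unfolding e(2) by (simp add: transpose_image_eq)
      then show False using a e by simp
    qed
    then show "d \<in> (`) (Transposition.transpose j k) ` ((`) \<sigma> ` L - L)" using e by blast
  qed
  then have "card ((`) \<tau> ` L - L) \<le> card ((`) (Transposition.transpose j k) ` ((`) \<sigma> ` L - L))"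
    by (rule card_mono[rotated]) (use finite_L in auto)
  also have "\<dots> \<le> card ((`) \<sigma> ` L - L)" by (rule card_image_le) (use finite_L in auto)
  also have "\<dots> \<le> 1" using assms by (simp add: near_def)
  finally have "\<tau> \<in> near (X - {j}) L i"
    using tB si i_in ij ki by (simp add: near_def \<tau>_def transpose_def)
  moreover have "\<sigma> x = swap_on X j k ((\<tau>(j := j)) x)" if "x \<in> X" for x
  proof (cases "x = j")
    case True
    then show ?thesis using j_in by (simp add: swap_on_def k_def)
  next
    case False
    then have "\<tau> x \<in> X" using that tB by (auto simp: Bij_def dest: bij_betwE)
    then show ?thesis using that False by (simp add: swap_on_def \<tau>_def)
  qed
  moreover have "deg L k \<le> 1"
    using deg_image_isolated[OF assms j_in deg_j] by (simp add: k_def)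
  ultimately show thesis using that kX ki by blast
qed

section \<open>Transitivity and the full stabilizer\<close>

lemma swap_on_H: "\<lbrakk>k \<in> X - {i}; deg L k \<le> 1\<rbrakk> \<Longrightarrow> swap_on X j k \<in> H"
  using near_swap_on near_H by blast

text \<open>Conjugating \<open>(j x)\<close> by \<open>g\<close> gives the transposition of
  \<open>g j\<close> and \<open>g x\<close>, and \<open>g\<close> fixes \<open>j\<close>.\<close>

lemma swap_on_conjugate:
  assumes g: "g \<in> H" "g j = j" and x: "x \<in> X" "swap_on X j x \<in> H"
  shows "swap_on X j (g x) \<in> H"
proof -
  interpret group "BijGroup X" by (rule group_BijGroup)
  have gB: "g \<in> Bij X" using H_Bij g by simp
  then have inj: "inj_on g X" and im: "g ` X = X" by (auto simp: Bij_def bij_betw_def)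
  have gx: "g x \<in> X" using im x by blast
  \<comment> \<open>The conjugation identity is first proved as a commutation relation, which can be
    checked pointwise without inverses.\<close>
  have "compose X (swap_on X j (g x)) g = compose X g (swap_on X j x)"
  proof (rule ext)
    fix z
    show "compose X (swap_on X j (g x)) g z = compose X g (swap_on X j x) z"
    proof (cases "z \<in> X")
      case True
      then have "g z \<in> X" using im by blast
      moreover have "g z = j \<longleftrightarrow> z = j" "g z = g x \<longleftrightarrow> z = x"
        using g(2) inj_on_eq_iff[OF inj True j_in] inj_on_eq_iff[OF inj True x(1)] by simp_all
      ultimately show ?thesis using True g(2)
        by (auto simp: compose_def swap_on_def transpose_def)
    qed (simp add: compose_def)
  qed
  then have "swap_on X j (g x) \<otimes>\<^bsub>BijGroup X\<^esub> g = g \<otimes>\<^bsub>BijGroup X\<^esub> swap_on X j x"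
    using BijGroup_mult[OF swap_on_Bij[OF j_in gx] gB]
      BijGroup_mult[OF gB swap_on_Bij[OF j_in x(1)]] by simp
  then have "swap_on X j (g x) = g \<otimes>\<^bsub>BijGroup X\<^esub> swap_on X j x \<otimes>\<^bsub>BijGroup X\<^esub> inv\<^bsub>BijGroup X\<^esub> g"
    using inv_solve_right[of "swap_on X j (g x)" "g \<otimes>\<^bsub>BijGroup X\<^esub> swap_on X j x" g]
      gB swap_on_Bij[OF j_in gx] swap_on_Bij[OF j_in x(1)] m_closed[of g "swap_on X j x"] by simp
  then show ?thesis
    using subgroup.m_closed[OF H_subgroup subgroup.m_closed[OF H_subgroup g(1) x(2)]
        subgroup.m_inv_closed[OF H_subgroup g(1)]] by simp
qed

text \<open>The set of all \<open>x\<close> with \<open>(j x)\<close> in \<open>H\<close> contains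
  \<open>j\<close> and is invariant under the generators, hence under \<open>H\<close>. It thus
  contains the orbit of \<open>j\<close>, which is everything except \<open>i\<close>.\<close>

lemma all_transpositions_if_transitive:
  assumes "\<And>x. x \<in> X - {i} \<Longrightarrow> \<exists>h\<in>H. h j = x" "x \<in> X - {i}"
  shows "swap_on X j x \<in> H"
proof -
  let ?S = "{x \<in> X - {i}. swap_on X j x \<in> H}"
  have jS: "j \<in> ?S" using swap_on_H[of j] deg_j j_in ij by auto
  have "\<sigma> ` ?S \<subseteq> ?S" if s: "\<sigma> \<in> near X L i" for \<sigma>
  proof
    fix y assume "y \<in> \<sigma> ` ?S"
    then obtain x where x: "x \<in> ?S" "y = \<sigma> x" by blast
    obtain \<tau> k where t: "\<tau> \<in> near (X - {j}) L i" and k: "k \<in> X - {i}" "deg L k \<le> 1"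
      and eq: "\<And>x. x \<in> X \<Longrightarrow> \<sigma> x = swap_on X j k ((\<tau>(j := j)) x)"
      using near_decompose[OF s] by blast
    let ?t = "\<tau>(j := j)"
    have tH: "?t \<in> H" using near_H near_extend t by blast
    define z where "z = ?t x"
    have "swap_on X j z \<in> H"
      unfolding z_def by (rule swap_on_conjugate[OF tH]) (use x in simp_all)
    moreover have "z \<in> X - {i}" unfolding z_def using H_image_minus_i[OF tH] x by blast
    ultimately have tS: "z \<in> ?S" by blast
    have kS: "k \<in> ?S" using k swap_on_H by blast
    \<comment> \<open>The factor \<open>?t\<close> preserves \<open>?S\<close> by conjugation, as it
      fixes \<open>j\<close>. The factor \<open>(j k)\<close> preserves it because \<open>j\<close>
      and \<open>k\<close> both belong to \<open>?S\<close>.\<close>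
    have "swap_on X j k z \<in> {z, j, k}"
      using tS by (simp add: swap_on_def transpose_def)
    moreover have "y = swap_on X j k z" unfolding z_def using x eq by blast
    ultimately have "y = z \<or> y = j \<or> y = k" by blast
    then show "y \<in> ?S" using tS jS kS by blast
  qed
  then have im: "h ` ?S = ?S" if "h \<in> H" for h by (rule H_image_eq[rotated]) (use that in auto)
  obtain h where "h \<in> H" "h j = x" using assms by blast
  then show ?thesis using im[of h] jS by blast
qed

text \<open>The stabilizer contains all transpositions of \<open>X - {i}\<close>, so it is
  transitive there. Conversely, transitivity gives every \<open>(j x)\<close>, and these generate
  the stabilizer.\<close>

lemma H_eq_stabilizer_iff:
  "H = {\<sigma> \<in> Bij X. \<sigma> i = i} \<longleftrightarrow> (\<forall>x\<in>X - {i}. \<forall>y\<in>X - {i}. \<exists>h\<in>H. h x = y)"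
proof
  assume H: "H = {\<sigma> \<in> Bij X. \<sigma> i = i}"
  show "\<forall>x\<in>X - {i}. \<forall>y\<in>X - {i}. \<exists>h\<in>H. h x = y"
  proof (intro ballI)
    fix x y assume xy: "x \<in> X - {i}" "y \<in> X - {i}"
    then have "swap_on X x y \<in> H"
      unfolding H using swap_on_Bij[of x X y] i_in by (auto simp: swap_on_def transpose_def)
    moreover have "swap_on X x y x = y" using xy by (simp add: swap_on_def)
    ultimately show "\<exists>h\<in>H. h x = y" by blast
  qed
next
  assume tr: "\<forall>x\<in>X - {i}. \<forall>y\<in>X - {i}. \<exists>h\<in>H. h x = y"
  then have sj: "swap_on X j x \<in> H" if "x \<in> X - {i}" for x
    using all_transpositions_if_transitive that j_in ij by auto
  have sw: "swap_on X a b \<in> H" if "a \<in> X - {i}" "b \<in> X - {i}" "a \<noteq> b" for a b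
  proof (cases "a = j \<or> b = j")
    case True
    then show ?thesis using sj that by (auto simp: swap_on_def transpose_commute)
  next
    case False
    \<comment> \<open>For distinct \<open>a\<close>, \<open>b\<close>, \<open>j\<close> this is
      \<open>(a b) = (j a)(j b)(j a)\<close>.\<close>
    then have "swap_on X a b =
        compose X (swap_on X j a) (compose X (swap_on X j b) (swap_on X j a))"
      using that j_in by (auto simp: fun_eq_iff swap_on_def compose_def transpose_def)
    then show ?thesis using H_compose sj that by simp
  qed
  have "\<sigma> \<in> H" if s: "\<sigma> \<in> Bij X" "\<sigma> i = i" for \<sigma>
  proof -
    obtain p where p: "p permutes (X - {i})" "\<sigma> = restrict p X"
      using Bij_fixing_extend_permutes[OF s i_in] by blast
    have "finite (X - {i})" using finite_X by simp
    with p(1) have "restrict p X \<in> H"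
    proof (induction rule: permutes_induct)
      case id
      show ?case using subgroup.one_closed[OF H_subgroup] by (simp add: BijGroup_def restrict_def)
    next
      case (swap a b p)
      have "p x \<in> X" if "x \<in> X" for x
        using permutes_in_image[OF permutes_subset[OF \<open>p permutes (X - {i})\<close>, of X]] that by auto
      then have "restrict (Transposition.transpose a b \<circ> p) X = compose X (swap_on X a b) (restrict p X)"
        by (auto simp: compose_def swap_on_def restrict_def)
      moreover have "compose X (swap_on X a b) (restrict p X) \<in> H"
        using swap by (intro H_compose sw)
      ultimately show ?case by (simp only:)
    qed
    then show ?thesis using p by simp
  qed
  then show "H = {\<sigma> \<in> Bij X. \<sigma> i = i}" using H_Bij H_fixes_i by blast
qed

section \<open>Transitivity and leaves in the orbits\<close>

lemma transitive_if_leaves: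
  assumes leaves: "\<And>x. x \<in> X - {i, j} \<Longrightarrow> \<exists>g\<in>base.H. deg L (g x) = 1"
    and xy: "x \<in> X - {i}" "y \<in> X - {i}"
  shows "\<exists>h\<in>H. h x = y"
proof -
  have reach: "\<exists>h\<in>H. h j = x" if x: "x \<in> X - {i}" for x
  proof (cases "x = j")
    case True
    then have "swap_on X j x \<in> H" using swap_on_H[of j] deg_j j_in ij by auto
    moreover have "swap_on X j x j = x" using True j_in by (simp add: swap_on_def)
    ultimately show ?thesis by blast
  next
    case False
    \<comment> \<open>The \<open>H\<close>-orbit of \<open>j\<close>, without \<open>j\<close>. It
      is invariant under \<open>base.H\<close> because the generators there extend to elements of
      \<open>H\<close>.\<close>
    let ?S = "{x \<in> X - {i, j}. \<exists>h\<in>H. h j = x}"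
    have "\<tau> ` ?S \<subseteq> ?S" if t: "\<tau> \<in> near (X - {j}) L i" for \<tau>
    proof
      fix y assume "y \<in> \<tau> ` ?S"
      then obtain x h where x: "x \<in> X - {i, j}" "h \<in> H" "h j = x" "y = \<tau> x" by blast
      have tH: "\<tau>(j := j) \<in> H" using near_H near_extend t by blast
      have "compose X (\<tau>(j := j)) h \<in> H" using H_compose tH x by blast
      moreover have "compose X (\<tau>(j := j)) h j = y" using x j_in by (simp add: compose_def)
      moreover have "\<tau> x \<in> X - {j} - {i}"
        using base.H_image_minus_i[OF base.near_H[OF t]] x by blast
      ultimately have "\<exists>h\<in>H. h j = y" "y \<in> X - {j} - {i}" using x(4) by metis+
      then show "y \<in> ?S" by blast
    qed
    then have im: "g ` ?S = ?S" if "g \<in> base.H" for g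
      by (rule base.H_image_eq[rotated]) (use that in auto)
    obtain g where g: "g \<in> base.H" "deg L (g x) = 1" using leaves[of x] x False by auto
    have gx: "g x \<in> X - {j} - {i}" using base.H_image_minus_i[OF g(1)] x False by blast
    then have "swap_on X j (g x) \<in> H" using swap_on_H[of "g x"] g by auto
    moreover have "swap_on X j (g x) j = g x" using j_in by (simp add: swap_on_def)
    ultimately have "g x \<in> ?S" using gx by blast
    \<comment> \<open>The leaf \<open>g x\<close> is reached from \<open>j\<close> by one swap.
      Since \<open>g\<close> permutes \<open>?S\<close> and is injective, \<open>x\<close> itself
      lies in \<open>?S\<close>.\<close>
    then obtain z where z: "z \<in> ?S" "g z = g x" using im[OF g(1)] by (metis (no_types, lifting) imageE)
    have "inj_on g (X - {j})" using base.H_Bij[OF g(1)] by (simp add: Bij_def bij_betw_def)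
    then have "z = x" using z x False by (auto dest: inj_onD)
    then show ?thesis using z by blast
  qed
  obtain h1 h2 where h: "h1 \<in> H" "h1 j = x" "h2 \<in> H" "h2 j = y" using reach xy by meson
  obtain h3 where h3: "h3 \<in> H" "h3 x = j" using H_sym[OF h(1) j_in] h by blast
  have "compose X h2 h3 x = y" using h h3 xy by (simp add: compose_def)
  then show ?thesis using H_compose[OF h(3) h3(1)] by blast
qed

text \<open>Contraposition with an orbit lacking leaves. If \<open>L\<close> is empty,
  \<open>H\<close> is the whole stabilizer and hence transitive, although no leaf exists; the
  assumption \<open>L\<close> rules this out unless only \<open>i\<close> and \<open>j\<close> are
  present.\<close>

lemma leaves_if_transitive:
  assumes tr: "\<And>x y. \<lbrakk>x \<in> X - {i}; y \<in> X - {i}\<rbrakk> \<Longrightarrow> \<exists>h\<in>H. h x = y"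
    and L: "L \<noteq> {} \<or> X = {i, j}"
    and x: "x \<in> X - {i, j}"
  shows "\<exists>g\<in>base.H. deg L (g x) = 1"
proof (rule ccontr)
  assume no: "\<not> (\<exists>g\<in>base.H. deg L (g x) = 1)"
  define Orb where "Orb = {g x | g. g \<in> base.H}"
  have OrbI: "g x \<in> Orb" if "g \<in> base.H" for g
    using that unfolding Orb_def by blast
  have OX: "Orb \<subseteq> X - {i, j}"
    using base.H_image_minus_i x unfolding Orb_def by blast
  have Ocl: "\<tau> y \<in> Orb" if t: "\<tau> \<in> near (X - {j}) L i" and y: "y \<in> Orb" for \<tau> y
  proof -
    obtain g where g: "g \<in> base.H" "y = g x" using y unfolding Orb_def by blast
    have "compose (X - {j}) \<tau> g \<in> base.H" using base.H_compose base.near_H t g by blast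
    moreover have "compose (X - {j}) \<tau> g x = \<tau> y" using g x by (simp add: compose_def)
    ultimately show ?thesis using OrbI by metis
  qed
  have xO: "x \<in> Orb"
  proof -
    have "restrict (\<lambda>x. x) (X - {j}) \<in> base.H"
      using subgroup.one_closed[OF base.H_subgroup] by (simp add: BijGroup_def)
    from OrbI[OF this] show ?thesis using x by simp
  qed
  show False
  \<comment> \<open>A leafless orbit either contains an isolated label or consists of labels of
    degree at least 2. Both cases yield an \<open>H\<close>-invariant set contradicting
    transitivity.\<close>
  proof (cases "\<exists>m\<in>Orb. deg L m = 0")
    case True
    then obtain m where m: "m \<in> Orb" "deg L m = 0" by blast
    then have mL: "m \<notin> e" if "e \<in> L" for e using finite_L that by (auto simp: deg_def)
    \<comment> \<open>The label \<open>m\<close> is isolated already without \<open>j\<close>, so it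
      can take the role of \<open>j\<close>: it may be swapped with any leaf other than
      \<open>i\<close>, which would put that leaf into the orbit.\<close>
    interpret m: isolated "X - {j}" L i m
      by unfold_locales (use m mL OX in auto)
    have noleaf: "deg L l \<noteq> 1" if "l \<in> X - {i, j}" for l
    proof
      assume "deg L l = 1"
      then have "swap_on (X - {j}) m l \<in> near (X - {j}) L i"
        using m.near_swap_on[of l] that by auto
      then have "swap_on (X - {j}) m l m \<in> Orb" using Ocl m by blast
      moreover have "swap_on (X - {j}) m l m = l" using m OX by (auto simp: swap_on_def)
      ultimately have "l \<in> Orb" by simp
      then show False using no \<open>deg L l = 1\<close> unfolding Orb_def by blast
    qed
    \<comment> \<open>Generators send isolated labels to labels of degree at most 1, and degree 1 is
      now excluded away from \<open>i\<close>. So \<open>?D\<close> is invariant, and transitivity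
      would make every label but \<open>i\<close> isolated.\<close>
    let ?D = "{y \<in> X - {i}. deg L y = 0}"
    have "\<sigma> ` ?D \<subseteq> ?D" if s: "\<sigma> \<in> near X L i" for \<sigma>
    proof
      fix z assume "z \<in> \<sigma> ` ?D"
      then obtain y where y: "y \<in> X - {i}" "deg L y = 0" "z = \<sigma> y" by blast
      have "z \<in> X - {i}" using H_image_minus_i[OF near_H[OF s]] y by blast
      moreover have "deg L z \<le> 1" using deg_image_isolated[OF s _ y(2)] y by simp
      ultimately show "z \<in> ?D" using noleaf[of z] deg_j by (cases "z = j") auto
    qed
    then have im: "h ` ?D = ?D" if "h \<in> H" for h by (rule H_image_eq[rotated]) (use that in auto)
    have D: "y \<in> ?D" if y: "y \<in> X - {i}" for y
    proof -
      obtain h where h: "h \<in> H" "h j = y" using tr[of j y] y j_in ij by auto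
      have "j \<in> ?D" using deg_j j_in ij by auto
      then have "h j \<in> h ` ?D" by (rule imageI)
      then show ?thesis unfolding im[OF h(1)] h(2) .
    qed
    \<comment> \<open>The label \<open>x\<close> rules out \<open>X = {i, j}\<close>, so an edge
      exists; one of its ends differs from \<open>i\<close>.\<close>
    obtain e where e: "e \<in> L" using L x by auto
    then have "\<not> e \<subseteq> {i}" using edge[OF e] card_mono[of "{i}" e] by auto
    then obtain y where y: "y \<in> e" "y \<noteq> i" by blast
    then have "deg L y = 0" using D[of y] edge[OF e] by blast
    then show False using e y finite_L by (auto simp: deg_def)
  next
    case False
    have "\<sigma> ` Orb \<subseteq> Orb" if s: "\<sigma> \<in> near X L i" for \<sigma>
    proof
      fix z assume "z \<in> \<sigma> ` Orb"
      then obtain y where y: "y \<in> Orb" "z = \<sigma> y" by blast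
      obtain \<tau> k where t: "\<tau> \<in> near (X - {j}) L i" and k: "k \<in> X - {i}" "deg L k \<le> 1"
        and eq: "\<And>x. x \<in> X \<Longrightarrow> \<sigma> x = swap_on X j k ((\<tau>(j := j)) x)"
        using near_decompose[OF s] by blast
      have tO: "\<tau> y \<in> Orb" using Ocl[OF t y(1)] .
      have "deg L (\<tau> y) \<noteq> 0" using tO False by auto
      moreover have "deg L (\<tau> y) \<noteq> 1" using tO no unfolding Orb_def by auto
      ultimately have "\<not> deg L (\<tau> y) \<le> 1" by simp
      \<comment> \<open>Degrees in \<open>Orb\<close> are at least 2, so the swap of
        \<open>j\<close> with \<open>k\<close> never touches it. Hence \<open>Orb\<close> is
        invariant under \<open>H\<close> and cannot reach \<open>j\<close>.\<close>
      then have "\<tau> y \<noteq> k" using k(2) by auto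
      moreover have "y \<in> X" "y \<noteq> j" "\<tau> y \<in> X" "\<tau> y \<noteq> j" using y(1) tO OX by auto
      ultimately have "z = \<tau> y" using eq[of y] y(2) by (simp add: swap_on_def transpose_def)
      then show "z \<in> Orb" using tO by simp
    qed
    then have im: "h ` Orb = Orb" if "h \<in> H" for h
      by (rule H_image_eq[rotated]) (use that OX in auto)
    obtain h where "h \<in> H" "h x = j" using tr[of x j] x j_in ij by auto
    then show False using im[of h] xO OX by blast
  qed
qed

end

section \<open>Fer groups of labeled graphs\<close>

locale lgraph =
  fixes G :: "('v, 'x) lgraph"
  assumes labeled: "labeled_graph G"
begin

lemma finite_verts: "finite (verts G)"
  and inj_lab: "inj_on (lab G) (verts G)"
  using labeled by (auto simp: labeled_graph_def)

lemma edgeD: "d \<in> edges G \<Longrightarrow> \<exists>u v. d = {u, v} \<and> u \<in> verts G \<and> v \<in> verts G \<and> u \<noteq> v"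
  using labeled by (auto simp: labeled_graph_def)

lemma vert_lab: "u \<in> verts G \<Longrightarrow> vert G (lab G u) = u"
  using inj_lab by (simp add: vert_def)

lemma lab_vert: "x \<in> labels G \<Longrightarrow> lab G (vert G x) = x"
  and vert_in: "x \<in> labels G \<Longrightarrow> vert G x \<in> verts G"
  by (auto simp: labels_def vert_lab)

lemma inj_vert: "inj_on (vert G) (labels G)"
  by (metis inj_onI lab_vert)

lemma edge_subset: "d \<in> edges G \<Longrightarrow> d \<subseteq> verts G"
  using edgeD by blast

lemma vert_lab_image: "d \<subseteq> verts G \<Longrightarrow> vert G ` lab G ` d = d"
  using vert_lab by (force simp: image_def)

lemma lab_vert_image: "e \<subseteq> labels G \<Longrightarrow> lab G ` vert G ` e = e"
  using lab_vert by (force simp: image_def)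

lemma edge_labels_eq: "edge_labels G = (`) (lab G) ` edges G"
proof (intro equalityI subsetI)
  fix e assume "e \<in> edge_labels G"
  then obtain a b where ab: "e = {a, b}" "a \<in> labels G" "b \<in> labels G"
    "{vert G a, vert G b} \<in> edges G" by (auto simp: edge_labels_def)
  then have "e = lab G ` {vert G a, vert G b}" by (simp add: lab_vert)
  then show "e \<in> (`) (lab G) ` edges G" using ab by blast
next
  fix e assume "e \<in> (`) (lab G) ` edges G"
  then obtain u v where "e = {lab G u, lab G v}" "{u, v} \<in> edges G" "u \<in> verts G" "v \<in> verts G"
    using edgeD by force
  moreover have "lab G u \<in> labels G" "lab G v \<in> labels G"
    using calculation by (auto simp: labels_def)
  ultimately show "e \<in> edge_labels G"
    unfolding edge_labels_def using vert_lab by fastforce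
qed

lemma edges_eq: "edges G = (`) (vert G) ` edge_labels G"
proof -
  have "(`) (vert G) ` (`) (lab G) ` edges G = (\<lambda>d. d) ` edges G"
    unfolding image_image[of "(`) (vert G)"]
    by (rule image_cong[OF refl]) (simp add: vert_lab_image edge_subset)
  then show ?thesis by (simp add: edge_labels_eq)
qed

lemma vert_image_in_edges: "e \<subseteq> labels G \<Longrightarrow> vert G ` e \<in> edges G \<longleftrightarrow> e \<in> edge_labels G"
  using edges_eq lab_vert_image by (metis edge_labels_eq imageI)

lemma edge_labelsD:
  assumes "e \<in> edge_labels G"
  shows "\<exists>a b. e = {a, b} \<and> a \<in> labels G \<and> b \<in> labels G \<and> a \<noteq> b"
proof -
  obtain a b where ab: "e = {a, b}" "a \<in> labels G" "b \<in> labels G" "{vert G a, vert G b} \<in> edges G"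
    using assms by (auto simp: edge_labels_def)
  then have "a \<noteq> b" using edgeD[OF ab(4)] by auto
  then show ?thesis using ab by blast
qed

lemma finite_labels: "finite (labels G)"
  using finite_verts by (simp add: labels_def)

lemma card_labels: "card (labels G) = card (verts G)"
  unfolding labels_def using inj_lab by (rule card_image)

lemma edge_system: "i \<in> labels G \<Longrightarrow> edge_system (labels G) (edge_labels G) i"
proof
  fix e assume "e \<in> edge_labels G"
  then show "e \<subseteq> labels G \<and> card e = 2" using edge_labelsD[of e] by auto
qed (use finite_labels in auto)

lemma inj_lab_image: "inj_on ((`) (lab G)) (edges G)"
  by (rule inj_on_inverseI[where g = "(`) (vert G)"]) (simp add: vert_lab_image edge_subset)

lemma degree_eq:
  assumes "v \<in> verts G"
  shows "degree G v = deg (edge_labels G) (lab G v)"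
proof -
  have "{e \<in> edge_labels G. lab G v \<in> e} = (`) (lab G) ` {d \<in> edges G. v \<in> d}"
    using inj_on_image_mem_iff[OF inj_lab assms edge_subset] unfolding edge_labels_eq by blast
  moreover have "inj_on ((`) (lab G)) {d \<in> edges G. v \<in> d}"
    by (rule inj_on_subset[OF inj_lab_image]) auto
  ultimately show ?thesis by (simp add: degree_def deg_def card_image)
qed

lemma leaf_label_iff:
  assumes "S \<subseteq> labels G"
  shows "(\<exists>v. leaf G v \<and> lab G v \<in> S) \<longleftrightarrow> (\<exists>x\<in>S. deg (edge_labels G) x = 1)"
proof
  assume "\<exists>v. leaf G v \<and> lab G v \<in> S"
  then show "\<exists>x\<in>S. deg (edge_labels G) x = 1" using degree_eq by (metis leaf_def)
next
  assume "\<exists>x\<in>S. deg (edge_labels G) x = 1"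
  then obtain x where x: "x \<in> S" "deg (edge_labels G) x = 1" by blast
  then have "x \<in> labels G" using assms by blast
  then have "leaf G (vert G x)" "lab G (vert G x) = x"
    using x degree_eq by (simp_all add: leaf_def vert_in lab_vert)
  then show "\<exists>v. leaf G v \<and> lab G v \<in> S" using x by metis
qed

section \<open>Relabelled graphs as sets of label pairs\<close>

text \<open>The label pairs of \<open>relabel G \<sigma>\<close>, written as subsets rather than
  explicit pairs so that \<open>near_preimage\<close> applies directly.\<close>

definition pullback :: "('x \<Rightarrow> 'x) \<Rightarrow> 'x set set" where
  "pullback \<sigma> = {e. e \<subseteq> labels G \<and> \<sigma> ` e \<in> edge_labels G}"

lemma pullbackD:
  assumes "\<sigma> \<in> Bij (labels G)" "e \<in> pullback \<sigma>"
  shows "\<exists>a b. e = {a, b} \<and> a \<in> labels G \<and> b \<in> labels G \<and> a \<noteq> b"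
proof -
  have "inj_on \<sigma> e" using assms by (auto simp: Bij_def bij_betw_def pullback_def intro: inj_on_subset)
  then have "card e = card (\<sigma> ` e)" by (simp add: card_image)
  also have "\<dots> = 2" using assms edge_labelsD[of "\<sigma> ` e"] by (auto simp: pullback_def card_2_iff)
  finally show ?thesis using assms by (auto simp: card_2_iff pullback_def)
qed

lemma edges_relabel:
  assumes "\<sigma> \<in> Bij (labels G)"
  shows "edges (relabel G \<sigma>) = (`) (vert G) ` pullback \<sigma>"
proof -
  have "d \<in> edges (relabel G \<sigma>) \<longleftrightarrow> d \<in> (`) (vert G) ` pullback \<sigma>" for d
  proof
    assume "d \<in> edges (relabel G \<sigma>)"
    then obtain a b where "d = {vert G a, vert G b}" "a \<in> labels G" "b \<in> labels G"
      "{\<sigma> a, \<sigma> b} \<in> edge_labels G" by (auto simp: relabel_def)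
    then have "{a, b} \<in> pullback \<sigma>" "d = vert G ` {a, b}" by (auto simp: pullback_def)
    then show "d \<in> (`) (vert G) ` pullback \<sigma>" by blast
  next
    assume "d \<in> (`) (vert G) ` pullback \<sigma>"
    then obtain e where e: "e \<in> pullback \<sigma>" "d = vert G ` e" by blast
    obtain a b where ab: "e = {a, b}" "a \<in> labels G" "b \<in> labels G"
      using pullbackD[OF assms e(1)] by blast
    then have "{\<sigma> a, \<sigma> b} \<in> edge_labels G" "d = {vert G a, vert G b}"
      using e by (auto simp: pullback_def)
    then show "d \<in> edges (relabel G \<sigma>)" using ab by (auto simp: relabel_def)
  qed
  then show ?thesis by blast
qed

lemma inj_vert_image: "inj_on ((`) (vert G)) (Pow (labels G))"
  using inj_vert by (rule inj_on_image_Pow)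

lemma edge_labels_Pow: "edge_labels G \<subseteq> Pow (labels G)"
  by (auto simp: edge_labels_def)

text \<open>\<open>relabel\<close> changes only the edges, and \<open>vert G\<close> acts
  injectively on sets of labels, so equality of graphs can be tested on label pairs.\<close>

lemma relabel_eq_iff:
  assumes "\<sigma> \<in> Bij (labels G)"
  shows "relabel G \<sigma> = G \<longleftrightarrow> pullback \<sigma> = edge_labels G"
proof -
  have "relabel G \<sigma> = G \<longleftrightarrow> edges (relabel G \<sigma>) = edges G"
    by (rule iffI, simp only:, rule lgraph.equality) (simp_all, simp_all add: relabel_def)
  also have "\<dots> \<longleftrightarrow> pullback \<sigma> = edge_labels G"
    unfolding edges_relabel[OF assms] edges_eq
    by (rule inj_on_image_eq_iff[OF inj_vert_image _ edge_labels_Pow]) (auto simp: pullback_def)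
  finally show ?thesis .
qed

lemma relabel_eq_replace_iff:
  assumes "\<sigma> \<in> Bij (labels G)" "e \<subseteq> labels G" "e' \<subseteq> labels G"
  shows "relabel G \<sigma> = replace_edge G e e' \<longleftrightarrow> pullback \<sigma> = edge_labels G - {e} \<union> {e'}"
proof -
  have "relabel G \<sigma> = replace_edge G e e' \<longleftrightarrow> edges (relabel G \<sigma>) = edges (replace_edge G e e')"
    by (rule iffI, simp only:, rule lgraph.equality)
      (simp_all, simp_all add: relabel_def replace_edge_def)
  also have "edges (replace_edge G e e') = (`) (vert G) ` (edge_labels G - {e} \<union> {e'})"
    using inj_on_image_set_diff[OF inj_vert_image, of "edge_labels G" "{e}"] edge_labels_Pow assms
    by (auto simp: replace_edge_def edges_eq)
  also have "edges (relabel G \<sigma>) = (`) (vert G) ` (edge_labels G - {e} \<union> {e'}) \<longleftrightarrow>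
      pullback \<sigma> = edge_labels G - {e} \<union> {e'}"
    unfolding edges_relabel[OF assms(1)]
    by (rule inj_on_image_eq_iff[OF inj_vert_image])
      (use edge_labels_Pow assms in \<open>auto simp: pullback_def\<close>)
  finally show ?thesis .
qed

text \<open>Transported to vertices through the labelling, \<open>\<sigma>\<close> itself is an
  isomorphism. This makes feasibility automatic once a relabelling is known to be an
  edge-replacement.\<close>

lemma relabel_isomorphic:
  assumes "\<sigma> \<in> Bij (labels G)"
  shows "graph_isomorphic (relabel G \<sigma>) G"
proof -
  let ?f = "vert G \<circ> (\<sigma> \<circ> lab G)"
  have B: "bij_betw \<sigma> (labels G) (labels G)" using assms by (simp add: Bij_def)
  have "bij_betw (lab G) (verts G) (labels G)"
    using inj_lab by (simp add: bij_betw_def labels_def)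
  moreover have "bij_betw (vert G) (labels G) (verts G)"
    unfolding bij_betw_def using inj_vert vert_lab_image[of "verts G"] by (simp add: labels_def)
  ultimately have f: "bij_betw ?f (verts G) (verts G)" using B by (blast intro: bij_betw_trans)
  have "{u, v} \<in> edges (relabel G \<sigma>) \<longleftrightarrow> {?f u, ?f v} \<in> edges G"
    if uv: "u \<in> verts G" "v \<in> verts G" for u v
  proof -
    have l: "{lab G u, lab G v} \<subseteq> labels G" using uv by (auto simp: labels_def)
    have "{u, v} = vert G ` {lab G u, lab G v}" using uv by (simp add: vert_lab)
    then have "{u, v} \<in> edges (relabel G \<sigma>) \<longleftrightarrow> {lab G u, lab G v} \<in> pullback \<sigma>"
      unfolding edges_relabel[OF assms]
      using inj_on_image_mem_iff[OF inj_vert_image, of "{lab G u, lab G v}" "pullback \<sigma>"] l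
      by (auto simp: pullback_def)
    also have "\<dots> \<longleftrightarrow> {\<sigma> (lab G u), \<sigma> (lab G v)} \<in> edge_labels G"
      using l by (simp add: pullback_def)
    also have "\<dots> \<longleftrightarrow> vert G ` {\<sigma> (lab G u), \<sigma> (lab G v)} \<in> edges G"
      using l B by (intro vert_image_in_edges[symmetric]) (auto dest: bij_betwE)
    finally show ?thesis by simp
  qed
  then show ?thesis unfolding graph_isomorphic_def
    using f by (intro exI[of _ ?f]) (auto simp: relabel_def)
qed

lemma complement_edge_labels:
  assumes "a \<in> labels G" "b \<in> labels G" "a \<noteq> b" "{a, b} \<notin> edge_labels G"
  shows "{a, b} \<in> edge_labels (complement G)"
proof -
  have "{vert G a, vert G b} \<notin> edges G" using vert_image_in_edges[of "{a, b}"] assms by simp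
  moreover have "vert G a \<noteq> vert G b" using assms inj_vert by (auto dest: inj_onD)
  moreover have "labels (complement G) = labels G" "vert (complement G) = vert G"
    by (simp_all add: labels_def vert_def complement_def)
  moreover from calculation have "{vert G a, vert G b} \<in> edges (complement G)"
    using assms(1,2) vert_in by (auto simp: complement_def)
  ultimately show ?thesis
    unfolding edge_labels_def using assms(1,2) by auto
qed

text \<open>The pullback has as many pairs as \<open>edge_labels G\<close>. If it has no pair
  outside, it equals that set and \<open>\<sigma>\<close> is an automorphism; if it has exactly one,
  then exactly one old pair is missing, and the two form the replacement.\<close>

lemma Fer_union_fixing_eq:
  assumes i: "i \<in> labels G"
  shows "Fer_union_fixing G i = near (labels G) (edge_labels G) i"
proof -
  interpret edge_system "labels G" "edge_labels G" i using edge_system[OF i] .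
  have "\<sigma> \<in> Fer_union G \<longleftrightarrow> card ((`) \<sigma> ` edge_labels G - edge_labels G) \<le> 1"
    if B: "\<sigma> \<in> Bij (labels G)" for \<sigma>
  proof -
    let ?L = "edge_labels G" and ?P = "pullback \<sigma>"
    have fP: "finite ?P" by (rule finite_subset[of _ "Pow (labels G)"]) (auto simp: pullback_def finite_labels)
    have c1: "card (?P - ?L) = card ((`) \<sigma> ` ?L - ?L)"
      using near_preimage[OF B] by (simp add: pullback_def)
    have c2: "card (?L - ?P) = card (?P - ?L)"
    proof -
      have "inj_on ((`) \<sigma>) ?P" "(`) \<sigma> ` ?P = ?L"
      proof -
        have I: "inj_on ((`) \<sigma>) (Pow (labels G))" and S: "(`) \<sigma> ` Pow (labels G) = Pow (labels G)"
          using B by (simp_all add: Bij_def bij_betw_def inj_on_image_Pow image_Pow_surj)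
        show "inj_on ((`) \<sigma>) ?P" by (rule inj_on_subset[OF I]) (auto simp: pullback_def)
        show "(`) \<sigma> ` ?P = ?L"
        proof (intro equalityI subsetI)
          fix e assume e: "e \<in> ?L"
          then have "e \<in> (`) \<sigma> ` Pow (labels G)" using S edge_labels_Pow by blast
          then obtain d where "d \<subseteq> labels G" "e = \<sigma> ` d" by blast
          then show "e \<in> (`) \<sigma> ` ?P" using e by (auto simp: pullback_def)
        qed (auto simp: pullback_def)
      qed
      then have "card ?P = card ?L" by (metis card_image)
      then show ?thesis
        using card_le_sym_Diff[of ?P ?L] card_le_sym_Diff[of ?L ?P] fP finite_L by simp
    qed
    show ?thesis
    proof
      assume "\<sigma> \<in> Fer_union G"
      then obtain r where r: "r \<in> feasible_replacements G" "\<sigma> \<in> Fer G r"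
        by (auto simp: Fer_union_def)
      then consider "\<sigma> \<in> Aut G"
        | e e' where "feasible G e e'" "relabel G \<sigma> = replace_edge G e e'"
        by (cases r) (auto simp: feasible_replacements_def)
      then show "card ((`) \<sigma> ` ?L - ?L) \<le> 1"
      proof cases
        case 1
        then have "?P = ?L" using relabel_eq_iff[OF B] by (simp add: Aut_def)
        then show ?thesis using c1 by simp
      next
        case (2 e e')
        have "edge_labels (complement G) \<subseteq> Pow (labels G)"
          by (auto simp: edge_labels_def complement_def labels_def)
        moreover have "e \<in> edge_labels G" "e' \<in> edge_labels (complement G) \<or> e' = e"
          using 2(1) by (auto simp: feasible_def edge_replacement_def)
        ultimately have "e \<subseteq> labels G" "e' \<subseteq> labels G"
          using edge_labels_Pow by blast+
        then have "?P = ?L - {e} \<union> {e'}"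
          using relabel_eq_replace_iff[OF B, of e e'] 2(2) by blast
        \<comment> \<open>Only the added pair can be new, whether or not it coincides with the
          removed one.\<close>
        then have "?P - ?L \<subseteq> {e'}" by auto
        then have "card (?P - ?L) \<le> card {e'}" by (rule card_mono[rotated]) simp
        then show ?thesis using c1 by simp
      qed
    next
      assume "card ((`) \<sigma> ` ?L - ?L) \<le> 1"
      then consider "card (?P - ?L) = 0" | "card (?P - ?L) = 1" using c1 by linarith
      then show "\<sigma> \<in> Fer_union G"
      proof cases
        case 1
        then have "card (?L - ?P) = 0" using c2 by simp
        then have "?P - ?L = {}" "?L - ?P = {}"
          using 1 fP finite_L by (simp_all only: card_0_eq finite_Diff)
        then have "\<sigma> \<in> Aut G" using B relabel_eq_iff[OF B] by (auto simp: Aut_def)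
        then show ?thesis by (force simp: Fer_union_def feasible_replacements_def)
      next
        case 2
        then obtain e' e where e: "?P - ?L = {e'}" "?L - ?P = {e}"
          using c2 by (metis card_1_singletonE)
        then have mem: "e' \<in> ?P" "e' \<notin> ?L" "e \<in> ?L" by blast+
        then have sub: "e \<subseteq> labels G" "e' \<subseteq> labels G"
          using edge_labels_Pow by (auto simp: pullback_def)
        have "?P = ?L - {e} \<union> {e'}" using e by blast
        then have eq: "relabel G \<sigma> = replace_edge G e e'" using relabel_eq_replace_iff[OF B sub] by simp
        have "e' \<in> edge_labels (complement G)"
          using pullbackD[OF B mem(1)] complement_edge_labels mem(2) by blast
        then have "feasible G e e'"
          using mem relabel_isomorphic[OF B] by (simp add: feasible_def edge_replacement_def eq)
        moreover have "e \<noteq> e'" using mem by blast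
        ultimately have "Replace e e' \<in> feasible_replacements G"
          by (auto simp: feasible_replacements_def)
        moreover have "\<sigma> \<in> Fer G (Replace e e')" using B eq by simp
        ultimately show ?thesis unfolding Fer_union_def by blast
      qed
    qed
  qed
  moreover have "Fer_union G \<subseteq> Bij (labels G)"
    by (auto simp: Fer_union_def feasible_replacements_def Aut_def)
  ultimately show ?thesis by (auto simp: Fer_union_fixing_def near_def)
qed

end

section \<open>Equivalence of stem-symmetry, transitivity and leaves in all orbits\<close>

text \<open>An edgeless graph with at least two vertices satisfies the first two conditions but not
  the third, as its orbits contain no leaf. The last hypothesis excludes this case.\<close>

theorem theorem2:
  fixes G Gs :: "('v, 'x) lgraph" and w :: 'v and i j :: 'x and X :: "'x set"
  assumes "labeled_graph G"
    and "i \<in> labels G"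
    and "w \<notin> verts G"
    and "j \<notin> labels G"
    and "Gs = add_isolated G w j"
    and "X = labels Gs"
    and "edges G \<noteq> {} \<or> card (verts G) = 1"
  shows "(stem_symmetric Gs i \<longleftrightarrow>
            transitive_action (Fer_group Gs i) (X - {i}) (natural_action (X - {i})))
       \<and> (transitive_action (Fer_group Gs i) (X - {i}) (natural_action (X - {i})) \<longleftrightarrow>
            (\<forall>Orb \<in> orbits (Fer_group G i) (X - {i, j}) (natural_action (X - {i, j})).
               \<exists>v. leaf G v \<and> lab G v \<in> Orb))"
proof -
  let ?L = "edge_labels G"
  interpret G: lgraph G by (rule lgraph.intro[OF assms(1)])
  have lab_eq: "lab Gs v = lab G v" if "v \<in> verts G" for v
    using that assms(3,5) by (auto simp: add_isolated_def)
  have V: "verts Gs = insert w (verts G)" "edges Gs = edges G"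
    using assms(5) by (simp_all add: add_isolated_def)
  have X: "X = insert j (labels G)"
  proof -
    have "lab Gs w = j" using assms(5) by (simp add: add_isolated_def)
    moreover have "lab Gs ` verts G = lab G ` verts G" using lab_eq by (rule image_cong[OF refl])
    ultimately show ?thesis by (simp add: assms(6) labels_def V)
  qed
  have "labeled_graph Gs"
  proof -
    have "edges Gs \<subseteq> {{u, v} |u v. u \<in> verts Gs \<and> v \<in> verts Gs \<and> u \<noteq> v}"
      using G.edgeD unfolding V by blast
    moreover have "inj_on (lab Gs) (verts Gs)"
      using G.inj_lab assms(3,4,5) lab_eq
      by (auto simp: V inj_on_def labels_def add_isolated_def image_iff)
    ultimately show ?thesis using G.finite_verts by (simp add: labeled_graph_def V)
  qed
  then interpret Gs: lgraph Gs by (rule lgraph.intro)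
  have L: "edge_labels Gs = ?L"
    unfolding Gs.edge_labels_eq G.edge_labels_eq V
    by (rule image_cong[OF refl], rule image_cong[OF refl]) (use G.edge_subset lab_eq in blast)
  have Xj: "X - {j} = labels G" using X assms(4) by auto
  interpret edge_system X ?L i
  proof -
    have "i \<in> X" using X assms(2) by simp
    then show "edge_system X ?L i" using Gs.edge_system[of i] assms(6) by (simp add: L)
  qed
  interpret isolated X ?L i j
    by unfold_locales (use X assms(2,4) G.edge_labels_Pow in auto)
  have Fs: "Fer_group Gs i = (BijGroup X)\<lparr>carrier := H\<rparr>"
    using Gs.Fer_union_fixing_eq[of i] i_in
    unfolding Fer_group_def H_def L assms(6)[symmetric] by simp
  have F: "Fer_group G i = (BijGroup (labels G))\<lparr>carrier := base.H\<rparr>"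
    using G.Fer_union_fixing_eq[OF assms(2)]
    unfolding Fer_group_def base.H_def Xj[symmetric] by simp
  let ?St = "{\<sigma> \<in> Bij X. \<sigma> i = i}"
  let ?tr = "\<forall>x\<in>X - {i}. \<forall>y\<in>X - {i}. \<exists>h\<in>H. h x = y"
  \<comment> \<open>\<open>transitive_action\<close> includes being a group action; with this
    settled only the existence of group elements joining two points remains.\<close>
  have "group_action (Fer_group Gs i) (X - {i}) (natural_action (X - {i}))"
    unfolding Fs by (rule group_action_restrict[OF H_subgroup]) (use H_image_minus_i in auto)
  then have tr: "transitive_action (Fer_group Gs i) (X - {i}) (natural_action (X - {i})) \<longleftrightarrow> ?tr"
    by (auto simp: transitive_action_def transitive_action_axioms_def natural_action_def Fs)
  have cX: "card (verts Gs) = card X" using Gs.card_labels assms(6) by simp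
  have iso: "(BijGroup X)\<lparr>carrier := ?St\<rparr> \<cong> sym_group (card X - 1)"
    by (rule stabilizer_iso_sym_group[OF finite_X i_in])
  have "stem_symmetric Gs i \<longleftrightarrow> H = ?St"
  proof
    assume "stem_symmetric Gs i"
    \<comment> \<open>The abstract isomorphism is used only for its cardinality: \<open>H\<close>
      lies in the finite stabilizer \<open>?St\<close>, so equal size forces equality.\<close>
    then have "card H = card ?St"
      using iso_same_card[OF iso] iso_same_card[of "Fer_group Gs i" "sym_group (card X - 1)"]
      by (simp add: stem_symmetric_def cX Fs)
    moreover have "H \<subseteq> ?St" using H_Bij H_fixes_i by blast
    moreover have "finite ?St" using finite_Bij[OF finite_X] by simp
    ultimately show "H = ?St" by (metis card_subset_eq)
  next
    assume "H = ?St"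
    then show "stem_symmetric Gs i" using iso by (simp add: stem_symmetric_def cX Fs)
  qed
  then have ab: "stem_symmetric Gs i \<longleftrightarrow> ?tr" using H_eq_stabilizer_iff by simp
  have nondeg: "?L \<noteq> {} \<or> X = {i, j}"
  proof -
    have "labels G = {i}" if "card (verts G) = 1"
      using that assms(2) G.card_labels by (metis card_1_singletonE singletonD)
    then show ?thesis using assms(7) X G.edge_labels_eq by auto
  qed
  have orb: "(\<exists>v. leaf G v \<and> lab G v \<in> orbit (Fer_group G i) (natural_action (X - {i, j})) x) \<longleftrightarrow>
      (\<exists>g\<in>base.H. deg ?L (g x) = 1)" if x: "x \<in> X - {i, j}" for x
  proof -
    \<comment> \<open>At a point of \<open>X - {i, j}\<close> the restricted permutation has the
      same value as the original one, so orbits can be computed by evaluation.\<close>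
    have o: "orbit (Fer_group G i) (natural_action (X - {i, j})) x = (\<lambda>g. g x) ` base.H"
      using x by (auto simp: orbit_def natural_action_def F)
    have "g x \<in> labels G" if "g \<in> base.H" for g
      using base.H_image_minus_i[OF that] x Xj by blast
    then show ?thesis unfolding o by (subst G.leaf_label_iff) auto
  qed
  have "(\<forall>Orb \<in> orbits (Fer_group G i) (X - {i, j}) (natural_action (X - {i, j})).
      \<exists>v. leaf G v \<and> lab G v \<in> Orb) \<longleftrightarrow> (\<forall>x\<in>X - {i, j}. \<exists>g\<in>base.H. deg ?L (g x) = 1)"
    unfolding orbits_def setcompr_eq_image Collect_mem_eq ball_simps
    by (intro ball_cong refl orb)
  also have "\<dots> \<longleftrightarrow> ?tr"
  proof
    assume "\<forall>x\<in>X - {i, j}. \<exists>g\<in>base.H. deg ?L (g x) = 1"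
    then show ?tr by (intro ballI transitive_if_leaves) (rule bspec)
  next
    assume transitive: ?tr
    show "\<forall>x\<in>X - {i, j}. \<exists>g\<in>base.H. deg ?L (g x) = 1"
      by (intro ballI leaves_if_transitive[OF _ nondeg] transitive[rule_format])
  qed
  finally show ?thesis using ab tr by blast
qed

end
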